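(* Let $q$ be a power of a prime $p$, $n\ge1$, $1\le r\le n$, $V=\mathbb{F}_q^{n+1}$, $\mathcal{L}_1$ the set of $1$-dimensional subspaces and $\mathcal{L}_r$ the set of $r$-dimensional subspaces of $V$, and let $A$ be the integer $|\mathcal{L}_r|\times|\mathcal{L}_1|$ $(0,1)$-matrix with $(Y,Z)$-entry $1$ iff $Z\subseteq Y$ (the matrix over $\mathbb{Z}$ of the map $\mathbb{Z}^{\mathcal{L}_1}\to\mathbb{Z}^{\mathcal{L}_r}$ sending each $Z\in\mathcal{L}_1$ to the formal sum of the $Y\in\mathcal{L}_r$ containing it). Let $v=|\mathcal{L}_1|$. Then the invariant factors of $A$ over $\mathbb{Z}$ are all powers of $p$, except the $v$-th invariant factor, which is a power of $p$ times $(q^r-1)/(q-1)$. *)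

theory Defs
  imports "HOL-Analysis.Cartesian_Space" "Jordan_Normal_Form.Matrix"
begin

definition subspaces_of_dim :: "nat \<Rightarrow> ('a::field ^ 'n::finite) set set" where
  "subspaces_of_dim r = {U. vec.subspace U \<and> vec.dim U = r}"

definition incidence_matrix :: "'b set list \<Rightarrow> 'b set list \<Rightarrow> int mat" where
  "incidence_matrix Ys Zs =
    mat (length Ys) (length Zs) (\<lambda>(i, j). if Zs ! j \<subseteq> Ys ! i then 1 else 0)"

text \<open>
  \<open>is_invariant_factors A ds\<close>: \<open>ds\<close> is the full diagonal of a Smith normal form of \<open>A\<close>
  over the integers, trailing zeros included when \<open>A\<close> does not have full rank. The entries are
  natural numbers, which fixes the signs. Over the integers \<open>invertible_mat\<close> means unimodular.
  Lists are indexed from 0, so the \<open>k\<close>-th invariant factor is \<open>ds ! (k - 1)\<close>.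
\<close>

definition is_invariant_factors :: "int mat \<Rightarrow> nat list \<Rightarrow> bool" where
  "is_invariant_factors A ds \<longleftrightarrow>
    length ds = min (dim_row A) (dim_col A) \<and>
    (\<forall>i. i + 1 < length ds \<longrightarrow> ds ! i dvd ds ! (i + 1)) \<and>
    (\<exists>P Q. P \<in> carrier_mat (dim_row A) (dim_row A) \<and> invertible_mat P \<and>
           Q \<in> carrier_mat (dim_col A) (dim_col A) \<and> invertible_mat Q \<and>
           P * A * Q = mat (dim_row A) (dim_col A) (\<lambda>(i, j). if i = j then int (ds ! i) else 0))"

end

theory Submission
  imports Defs "Jordan_Normal_Form.Gauss_Jordan_Elimination" "HOL-Computational_Algebra.Primes"
begin

text \<open>
  Let \<open>m = (q ^ r - 1) / (q - 1)\<close> be the number of points of an \<open>r\<close>-space, so that every row of \<open>A\<close>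
  sums to \<open>m\<close>. For two points \<open>z1\<close>, \<open>z2\<close> choose an \<open>(r + 1)\<close>-space \<open>W\<close> containing both. The
  hyperplanes of \<open>W\<close> containing \<open>z1\<close> but not \<open>z2\<close>, minus those containing \<open>z2\<close> but not \<open>z1\<close>, sum
  to a power of \<open>p\<close> times \<open>z1 - z2\<close>, because points off the line \<open>z1 z2\<close> lie equally often in
  hyperplanes of either kind. Hence, up to powers of \<open>p\<close>, the row lattice of \<open>A\<close> contains all
  differences of points, and the quotient by it is cyclic of order \<open>m\<close>, which is prime to \<open>p\<close>.

  In terms of a Smith normal form \<open>P A Q = D\<close>: a vector \<open>x\<close> with \<open>A x\<close> divisible by a prime
  \<open>l \<noteq> p\<close> is constant modulo \<open>l\<close>, so at most one column of \<open>D\<close> vanishes modulo \<open>l\<close>. That the last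
  invariant factor absorbs all of \<open>m\<close> follows by applying \<open>A\<close> to the all-one vector.
\<close>

subsection \<open>Smith normal form over the integers\<close>

lemma invertible_mat_iff:
  assumes "P \<in> carrier_mat n n"
  shows "invertible_mat P \<longleftrightarrow> (\<exists>P' \<in> carrier_mat n n. P * P' = 1\<^sub>m n \<and> P' * P = 1\<^sub>m n)"
proof
  assume "invertible_mat P"
  then obtain P' where P': "P * P' = 1\<^sub>m n" "P' * P = 1\<^sub>m (dim_row P')"
    using assms unfolding invertible_mat_def inverts_mat_def by auto
  have "dim_col P' = n"
    using arg_cong[OF P'(1), of dim_col] by simp
  moreover have "dim_row P' = n"
    using arg_cong[OF P'(2), of dim_col] assms by simp
  ultimately show "\<exists>P' \<in> carrier_mat n n. P * P' = 1\<^sub>m n \<and> P' * P = 1\<^sub>m n"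
    using P' by auto
next
  assume "\<exists>P' \<in> carrier_mat n n. P * P' = 1\<^sub>m n \<and> P' * P = 1\<^sub>m n"
  then show "invertible_mat P"
    using assms unfolding invertible_mat_def inverts_mat_def by auto
qed

lemma invertible_mat_mult:
  fixes P Q :: "'a::comm_ring_1 mat"
  assumes P: "P \<in> carrier_mat n n" "invertible_mat P"
    and Q: "Q \<in> carrier_mat n n" "invertible_mat Q"
  shows "invertible_mat (P * Q)"
proof -
  obtain P' Q' where P': "P' \<in> carrier_mat n n" "P * P' = 1\<^sub>m n" "P' * P = 1\<^sub>m n"
    and Q': "Q' \<in> carrier_mat n n" "Q * Q' = 1\<^sub>m n" "Q' * Q = 1\<^sub>m n"
    using P Q invertible_mat_iff by metis
  have "(P * Q) * (Q' * P') = P * (Q * Q') * P'"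
    using P Q P'(1) Q'(1) by (simp add: assoc_mult_mat[of _ n n _ n _ n])
  moreover have "(Q' * P') * (P * Q) = Q' * (P' * P) * Q"
    using P Q P'(1) Q'(1) by (simp add: assoc_mult_mat[of _ n n _ n _ n])
  ultimately show ?thesis
    using P Q P' Q' invertible_mat_iff[OF mult_carrier_mat[OF P(1) Q(1)]] mult_carrier_mat[OF Q'(1) P'(1)] by auto
qed

lemma invertible_mat_transpose:
  fixes P :: "'a::comm_ring_1 mat"
  assumes P: "P \<in> carrier_mat n n" "invertible_mat P"
  shows "invertible_mat (transpose_mat P)"
proof -
  obtain P' where P': "P' \<in> carrier_mat n n" "P * P' = 1\<^sub>m n" "P' * P = 1\<^sub>m n"
    using P invertible_mat_iff by metis
  then have "transpose_mat P * transpose_mat P' = 1\<^sub>m n" "transpose_mat P' * transpose_mat P = 1\<^sub>m n"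
    using P by (metis transpose_mult transpose_one)+
  then show ?thesis
    using P P'(1) invertible_mat_iff[of "transpose_mat P" n] by (auto intro!: bexI[of _ "transpose_mat P'"])
qed

text \<open>This is \<open>is_invariant_factors\<close> without the diagonal shape, so that single
  steps of the reduction can be chained.\<close>

definition unimodular_equiv :: "int mat \<Rightarrow> int mat \<Rightarrow> bool" where
  "unimodular_equiv A B \<longleftrightarrow>
    (\<exists>P Q. P \<in> carrier_mat (dim_row A) (dim_row A) \<and> invertible_mat P \<and>
           Q \<in> carrier_mat (dim_col A) (dim_col A) \<and> invertible_mat Q \<and> B = P * A * Q)"

lemma unimodular_equivI:
  assumes "A \<in> carrier_mat nr nc" "P \<in> carrier_mat nr nr" "invertible_mat P"
    "Q \<in> carrier_mat nc nc" "invertible_mat Q" "B = P * A * Q"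
  shows "unimodular_equiv A B"
  using assms unfolding unimodular_equiv_def by (metis carrier_matD)

lemma unimodular_equiv_carrier:
  "unimodular_equiv A B \<Longrightarrow> A \<in> carrier_mat nr nc \<Longrightarrow> B \<in> carrier_mat nr nc"
  unfolding unimodular_equiv_def by auto

lemma invertible_one_mat: "invertible_mat (1\<^sub>m n :: 'a::comm_ring_1 mat)"
  using invertible_mat_iff[of "1\<^sub>m n" n] by auto

lemma unimodular_equiv_left:
  assumes "A \<in> carrier_mat nr nc" "P \<in> carrier_mat nr nr" "invertible_mat P"
  shows "unimodular_equiv A (P * A)"
  by (rule unimodular_equivI[OF assms one_carrier_mat invertible_one_mat]) (use assms in auto)

lemma unimodular_equiv_refl: "unimodular_equiv A A"
  using unimodular_equiv_left[of A "dim_row A" "dim_col A" "1\<^sub>m (dim_row A)"] invertible_one_mat by auto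

lemma unimodular_equiv_trans:
  assumes "unimodular_equiv A B" "unimodular_equiv B C"
  shows "unimodular_equiv A C"
proof -
  obtain P Q where 1: "P \<in> carrier_mat (dim_row A) (dim_row A)" "invertible_mat P"
    "Q \<in> carrier_mat (dim_col A) (dim_col A)" "invertible_mat Q" "B = P * A * Q"
    using assms(1) unfolding unimodular_equiv_def by blast
  have B: "B \<in> carrier_mat (dim_row A) (dim_col A)"
    using unimodular_equiv_carrier[OF assms(1)] by auto
  obtain R S where 2: "R \<in> carrier_mat (dim_row A) (dim_row A)" "invertible_mat R"
    "S \<in> carrier_mat (dim_col A) (dim_col A)" "invertible_mat S" "C = R * B * S"
    using assms(2) B unfolding unimodular_equiv_def by auto
  have PA: "P * A \<in> carrier_mat (dim_row A) (dim_col A)"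
    using 1 by auto
  have "C = R * (P * A * Q) * S"
    using 1 2 by simp
  also have "\<dots> = (R * (P * A)) * Q * S"
    using assoc_mult_mat[OF 2(1) PA 1(3)] by simp
  also have "\<dots> = (R * (P * A)) * (Q * S)"
    using assoc_mult_mat[OF mult_carrier_mat[OF 2(1) PA] 1(3) 2(3)] .
  also have "\<dots> = (R * P) * A * (Q * S)"
    using assoc_mult_mat[OF 2(1) 1(1) carrier_matI[of A]] by auto
  finally show ?thesis
    using 1 2 invertible_mat_mult by (intro unimodular_equivI[of A "dim_row A" "dim_col A" "R * P" "Q * S"]) auto
qed

text \<open>Transposing before and after turns row operations into column operations, so only the
  former are treated directly.\<close>

lemma unimodular_equiv_transpose:
  assumes "unimodular_equiv A B"
  shows "unimodular_equiv (transpose_mat A) (transpose_mat B)"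
proof -
  obtain P Q where 1: "P \<in> carrier_mat (dim_row A) (dim_row A)" "invertible_mat P"
    "Q \<in> carrier_mat (dim_col A) (dim_col A)" "invertible_mat Q" "B = P * A * Q"
    using assms(1) unfolding unimodular_equiv_def by blast
  have A: "A \<in> carrier_mat (dim_row A) (dim_col A)"
    by simp
  have "transpose_mat B = transpose_mat Q * (transpose_mat A * transpose_mat P)"
    unfolding 1(5) transpose_mult[OF mult_carrier_mat[OF 1(1) A] 1(3)] transpose_mult[OF 1(1) A] ..
  also have "\<dots> = transpose_mat Q * transpose_mat A * transpose_mat P"
    by (rule assoc_mult_mat[symmetric, of _ "dim_col A" "dim_col A" _ "dim_row A" _ "dim_row A"]) (use 1 in auto)
  finally show ?thesis
    using 1 invertible_mat_transpose
    by (intro unimodular_equivI[of "transpose_mat A" "dim_col A" "dim_row A" "transpose_mat Q" "transpose_mat P"]) auto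
qed

section \<open>Elementary operations and pivots of least absolute value\<close>

lemma unimodular_equiv_swaprows:
  assumes "A \<in> carrier_mat nr nc" "k < nr" "l < nr"
  shows "unimodular_equiv A (swaprows k l A)"
  unfolding swaprows_mat[OF assms] using assms
  by (intro unimodular_equiv_left) (auto simp: invertible_mat_iff[of _ nr] swaprows_mat_inv intro!: bexI[of _ "swaprows_mat nr k l"])

lemma unimodular_equiv_addrow:
  assumes "A \<in> carrier_mat nr nc" "k < nr" "l < nr" "k \<noteq> l"
  shows "unimodular_equiv A (addrow a k l A)"
  unfolding addrow_mat[OF assms(1,3)] using assms addrow_mat_inv[of k nr l a] addrow_mat_inv[of k nr l "- a"]
  by (intro unimodular_equiv_left) (auto simp: invertible_mat_iff[of _ nr] intro!: bexI[of _ "addrow_mat nr (- a) k l"])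

text \<open>Minimality ranges over the whole equivalence class of \<open>B\<close>, not only over
  its own entries. A nonzero remainder produced by any operation is then an immediate contradiction,
  which replaces a termination argument for repeated division.\<close>

definition minimal_pivot :: "int mat \<Rightarrow> bool" where
  "minimal_pivot B \<longleftrightarrow> 0 < dim_row B \<and> 0 < dim_col B \<and> B $$ (0,0) \<noteq> 0 \<and>
    (\<forall>C i j. unimodular_equiv B C \<longrightarrow> i < dim_row B \<longrightarrow> j < dim_col B \<longrightarrow> C $$ (i,j) \<noteq> 0 \<longrightarrow>
      \<bar>B $$ (0,0)\<bar> \<le> \<bar>C $$ (i,j)\<bar>)"

lemma minimal_pivot_equiv:
  assumes "minimal_pivot B" "unimodular_equiv B C" "C $$ (0,0) = B $$ (0,0)"
  shows "minimal_pivot C"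
  using assms unimodular_equiv_trans[OF assms(2)] unimodular_equiv_carrier[OF assms(2), of "dim_row B" "dim_col B"]
  unfolding minimal_pivot_def by auto

lemma minimal_pivot_transpose:
  assumes "minimal_pivot B"
  shows "minimal_pivot (transpose_mat B)"
  unfolding minimal_pivot_def
proof (intro conjI allI impI)
  fix C i j
  assume C: "unimodular_equiv (transpose_mat B) C"
    and ij: "i < dim_row (transpose_mat B)" "j < dim_col (transpose_mat B)" "C $$ (i, j) \<noteq> 0"
  have eq: "unimodular_equiv B (transpose_mat C)"
    using unimodular_equiv_transpose[OF C] by simp
  have d: "C \<in> carrier_mat (dim_col B) (dim_row B)"
    by (rule unimodular_equiv_carrier[OF C]) auto
  then have "transpose_mat C $$ (j,i) = C $$ (i,j)"
    using ij by auto
  moreover have "\<bar>B $$ (0,0)\<bar> \<le> \<bar>X $$ (j,i)\<bar>" if "unimodular_equiv B X" "X $$ (j,i) \<noteq> 0" for X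
    using assms that ij unfolding minimal_pivot_def by auto
  ultimately have "\<bar>B $$ (0,0)\<bar> \<le> \<bar>C $$ (i,j)\<bar>"
    using eq ij by metis
  then show "\<bar>transpose_mat B $$ (0, 0)\<bar> \<le> \<bar>C $$ (i, j)\<bar>"
    using assms unfolding minimal_pivot_def by simp
qed (use assms in \<open>auto simp: minimal_pivot_def\<close>)

text \<open>Among all nonzero entries of all matrices equivalent to \<open>A\<close>, one of least
  absolute value exists; a row swap and a column swap bring it to the corner.\<close>

lemma exists_minimal_pivot:
  assumes A: "A \<in> carrier_mat nr nc" and "A \<noteq> 0\<^sub>m nr nc"
  shows "\<exists>B. unimodular_equiv A B \<and> minimal_pivot B"
proof -
  define S where "S = (\<lambda>(B, i, j). nat \<bar>B $$ (i,j)\<bar>) ` {(B, i, j). unimodular_equiv A B \<and> i < nr \<and> j < nc \<and> B $$ (i,j) \<noteq> 0}"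
  obtain i0 j0 where "i0 < nr" "j0 < nc" "A $$ (i0,j0) \<noteq> 0"
    using assms by (metis carrier_matD eq_matI index_zero_mat)
  then have "nat \<bar>A $$ (i0,j0)\<bar> \<in> S"
    unfolding S_def using unimodular_equiv_refl by (auto intro!: image_eqI[of _ _ "(A, i0, j0)"])
  then have "(LEAST s. s \<in> S) \<in> S" and least: "\<And>s. s \<in> S \<Longrightarrow> (LEAST s. s \<in> S) \<le> s"
    by (auto intro: LeastI Least_le)
  then obtain B i j where B: "unimodular_equiv A B" "i < nr" "j < nc" "B $$ (i,j) \<noteq> 0"
    "(LEAST s. s \<in> S) = nat \<bar>B $$ (i,j)\<bar>"
    unfolding S_def by auto
  have cB: "B \<in> carrier_mat nr nc"
    using unimodular_equiv_carrier[OF B(1) A] .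
  define C where "C = swaprows 0 i B"
  have BC: "unimodular_equiv B C" "C \<in> carrier_mat nr nc"
    unfolding C_def using unimodular_equiv_swaprows[OF cB] B cB by auto
  define D where "D = transpose_mat (swaprows 0 j (transpose_mat C))"
  have "unimodular_equiv (transpose_mat C) (swaprows 0 j (transpose_mat C))"
    using unimodular_equiv_swaprows[of "transpose_mat C" nc nr 0 j] B BC by auto
  then have CD: "unimodular_equiv C D"
    unfolding D_def using unimodular_equiv_transpose by fastforce
  have AD: "unimodular_equiv A D"
    using unimodular_equiv_trans B BC CD by blast
  have cD: "D \<in> carrier_mat nr nc"
    using unimodular_equiv_carrier[OF AD A] .
  have D00: "D $$ (0,0) = B $$ (i,j)"
    unfolding D_def C_def using cB B by auto
  have "\<bar>B $$ (i,j)\<bar> \<le> \<bar>E $$ (k,l)\<bar>" if "unimodular_equiv D E" "k < nr" "l < nc" "E $$ (k,l) \<noteq> 0" for E k l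
  proof -
    have "nat \<bar>E $$ (k,l)\<bar> \<in> S"
      unfolding S_def using that unimodular_equiv_trans[OF AD that(1)] by (auto intro!: image_eqI[of _ _ "(E, k, l)"])
    from least[OF this] show ?thesis
      unfolding B(5) by auto
  qed
  then have "minimal_pivot D"
    unfolding minimal_pivot_def using cD D00 B by auto
  then show ?thesis
    using AD by blast
qed

text \<open>Subtracting a multiple of row 0 replaces the entry by its remainder modulo the pivot,
  and minimality forces that remainder to be 0.\<close>

lemma minimal_pivot_dvd_col:
  assumes "minimal_pivot B" "i < dim_row B"
  shows "B $$ (0,0) dvd B $$ (i,0)"
proof (cases "i = 0")
  case False
  define d where "d = B $$ (0,0)"
  define C where "C = addrow (- (B $$ (i,0) div d)) i 0 B"
  have pos: "0 < dim_row B" "0 < dim_col B" "d \<noteq> 0"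
    using assms unfolding minimal_pivot_def d_def by auto
  have "unimodular_equiv B C"
    unfolding C_def using assms False pos by (intro unimodular_equiv_addrow[of _ "dim_row B" "dim_col B"]) auto
  moreover have "C $$ (i,0) = B $$ (i,0) mod d"
    unfolding C_def using assms pos by (simp add: d_def minus_div_mult_eq_mod[symmetric])
  ultimately have "B $$ (i,0) mod d \<noteq> 0 \<longrightarrow> \<bar>d\<bar> \<le> \<bar>B $$ (i,0) mod d\<bar>"
    using assms pos unfolding minimal_pivot_def d_def by metis
  then show ?thesis
    using abs_mod_less[of d "B $$ (i,0)"] pos(3) unfolding d_def by auto
qed auto

text \<open>Row 0 is kept, so that a row cleared earlier stays cleared.\<close>

lemma minimal_pivot_clear_col:
  assumes B: "minimal_pivot B"
  shows "\<exists>C. unimodular_equiv B C \<and> minimal_pivot C \<and> (\<forall>j<dim_col B. C $$ (0,j) = B $$ (0,j)) \<and>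
    (\<forall>i. 0 < i \<longrightarrow> i < dim_row B \<longrightarrow> C $$ (i,0) = 0)"
proof -
  define nr nc where "nr = dim_row B" and "nc = dim_col B"
  have cB: "B \<in> carrier_mat nr nc" and pos: "0 < nr" "0 < nc"
    using B unfolding nr_def nc_def minimal_pivot_def by auto
  have "\<forall>i. \<exists>c. i < nr \<longrightarrow> B $$ (i,0) = B $$ (0,0) * c"
    using minimal_pivot_dvd_col[OF B] unfolding nr_def dvd_def by metis
  then obtain c where c: "\<And>i. i < nr \<Longrightarrow> B $$ (i,0) = B $$ (0,0) * c i"
    by metis
  \<comment> \<open>\<open>E s\<close> adds \<open>s * c i\<close> times row 0 to every row
    \<open>i \<noteq> 0\<close> at once. Its inverse is \<open>E (- s)\<close>, and
    \<open>E (-1)\<close> clears the column.\<close>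
  define E where "E s = mat nr nr (\<lambda>(i,k). (if i = k then 1 else 0) + (if k = 0 \<and> i \<noteq> 0 then s * c i else 0))" for s :: int
  have cE: "E s \<in> carrier_mat nr nr" for s
    unfolding E_def by auto
  have E_mult: "(E s * X) $$ (i,j) = X $$ (i,j) + (if i \<noteq> 0 then s * c i * X $$ (0,j) else 0)"
    if "X \<in> carrier_mat nr m" "i < nr" "j < m" for s X i j m
  proof -
    have "(E s * X) $$ (i,j) = (\<Sum>k = 0..<nr. E s $$ (i,k) * X $$ (k,j))"
      using that cE[of s] by (auto simp: scalar_prod_def)
    also have "\<dots> = (\<Sum>k = 0..<nr. (if k = i then X $$ (k,j) else 0) + (if k = 0 then (if i \<noteq> 0 then s * c i * X $$ (0,j) else 0) else 0))"
      unfolding E_def using that by (intro sum.cong) auto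
    also have "\<dots> = X $$ (i,j) + (if i \<noteq> 0 then s * c i * X $$ (0,j) else 0)"
      using that pos unfolding sum.distrib by (subst (1 2) sum.delta) auto
    finally show ?thesis .
  qed
  have "E s * E (- s) = 1\<^sub>m nr" for s
  proof (rule eq_matI)
    fix i j
    assume "i < dim_row (1\<^sub>m nr :: int mat)" "j < dim_col (1\<^sub>m nr :: int mat)"
    then have "i < nr" "j < nr"
      by simp_all
    then show "(E s * E (- s)) $$ (i,j) = 1\<^sub>m nr $$ (i,j)"
      unfolding E_mult[OF cE \<open>i < nr\<close> \<open>j < nr\<close>] using pos by (simp add: E_def)
  qed (simp_all add: E_def)
  from this[of 1] this[of "-1"] have "invertible_mat (E (-1))"
    using invertible_mat_iff[OF cE] cE by auto
  then have eq: "unimodular_equiv B (E (-1) * B)"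
    using unimodular_equiv_left[OF cB cE] by blast
  have row: "(E (-1) * B) $$ (0,j) = B $$ (0,j)" if "j < nc" for j
    using E_mult[OF cB, of 0 j] that pos by auto
  have col: "(E (-1) * B) $$ (i,0) = 0" if "0 < i" "i < nr" for i
    using E_mult[OF cB, of i 0] that pos c[of i] by auto
  show ?thesis
    using minimal_pivot_equiv[OF B eq row[OF pos(2)]] eq row col unfolding nr_def nc_def
    by (intro exI[of _ "E (-1) * B"]) simp
qed

lemma minimal_pivot_dvd_row:
  assumes "minimal_pivot B" "j < dim_col B"
  shows "B $$ (0,0) dvd B $$ (0,j)"
proof -
  have "0 < dim_row B"
    using assms unfolding minimal_pivot_def by simp
  then show ?thesis
    using minimal_pivot_dvd_col[OF minimal_pivot_transpose[OF assms(1)], of j] assms(2) by auto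
qed

text \<open>Adding row \<open>i\<close> to row 0 leaves the corner unchanged because column 0 is
  already cleared. The corner therefore divides both \<open>B $$ (0,j)\<close> and
  \<open>B $$ (0,j) + B $$ (i,j)\<close>.\<close>

lemma minimal_pivot_dvd:
  assumes B: "minimal_pivot B" and col: "\<And>i. 0 < i \<Longrightarrow> i < dim_row B \<Longrightarrow> B $$ (i,0) = 0"
    and ij: "i < dim_row B" "j < dim_col B"
  shows "B $$ (0,0) dvd B $$ (i,j)"
proof (cases "i = 0")
  case True
  then show ?thesis
    using minimal_pivot_dvd_row[OF B ij(2)] by simp
next
  case False
  have pos: "0 < dim_row B" "0 < dim_col B"
    using B unfolding minimal_pivot_def by auto
  define C where "C = addrow 1 0 i B"
  have BC: "unimodular_equiv B C"
    unfolding C_def using ij pos False by (intro unimodular_equiv_addrow) auto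
  have C00: "C $$ (0,0) = B $$ (0,0)"
    unfolding C_def using pos ij False col by auto
  have "C $$ (0,0) dvd C $$ (0,j)"
    using minimal_pivot_dvd_row[OF minimal_pivot_equiv[OF B BC C00]] ij unfolding C_def by auto
  then show ?thesis
    unfolding C00 using pos ij minimal_pivot_dvd_row[OF B ij(2)] unfolding C_def by (auto simp: dvd_add_left_iff)
qed

lemma exists_pivot_block:
  assumes A: "A \<in> carrier_mat nr nc" and "A \<noteq> 0\<^sub>m nr nc"
  shows "\<exists>m n d B. nr = Suc m \<and> nc = Suc n \<and> d \<noteq> 0 \<and> B \<in> carrier_mat m n \<and>
    (\<forall>i<m. \<forall>j<n. d dvd B $$ (i,j)) \<and>
    unimodular_equiv A (four_block_mat (mat 1 1 (\<lambda>_. d)) (0\<^sub>m 1 n) (0\<^sub>m m 1) B)"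
proof -
  obtain B where B: "unimodular_equiv A B" "minimal_pivot B"
    using exists_minimal_pivot[OF assms] by blast
  have cB: "B \<in> carrier_mat nr nc"
    using unimodular_equiv_carrier[OF B(1) A] .
  have pos: "0 < nr" "0 < nc"
    using B(2) cB unfolding minimal_pivot_def by auto
  \<comment> \<open>Row 0 is cleared first, as a column of the transpose; column 0 follows.\<close>
  obtain C where C: "unimodular_equiv (transpose_mat B) C" "minimal_pivot C"
    "\<And>i. 0 < i \<Longrightarrow> i < nc \<Longrightarrow> C $$ (i,0) = 0"
    using minimal_pivot_clear_col[OF minimal_pivot_transpose[OF B(2)]] cB by auto
  have BC: "unimodular_equiv B (transpose_mat C)"
    using unimodular_equiv_transpose[OF C(1)] by simp
  have cC: "C \<in> carrier_mat nc nr"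
    using unimodular_equiv_carrier[OF C(1)] cB by auto
  obtain D where D: "unimodular_equiv (transpose_mat C) D" "minimal_pivot D"
    "\<And>j. j < nc \<Longrightarrow> D $$ (0,j) = transpose_mat C $$ (0,j)"
    "\<And>i. 0 < i \<Longrightarrow> i < nr \<Longrightarrow> D $$ (i,0) = 0"
    using minimal_pivot_clear_col[OF minimal_pivot_transpose[OF C(2)]] cC by auto
  have AD: "unimodular_equiv A D"
    using unimodular_equiv_trans B(1) BC D(1) by blast
  have cD: "D \<in> carrier_mat nr nc"
    using unimodular_equiv_carrier[OF AD A] .
  have row: "D $$ (0,j) = 0" if "0 < j" "j < nc" for j
    using D(3)[of j] C(3)[of j] that cC pos by auto
  obtain m n where mn: "nr = Suc m" "nc = Suc n"
    using pos by (auto simp: gr0_conv_Suc)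
  define E where "E = mat m n (\<lambda>(i,j). D $$ (Suc i, Suc j))"
  have "D = four_block_mat (mat 1 1 (\<lambda>_. D $$ (0,0))) (0\<^sub>m 1 n) (0\<^sub>m m 1) E"
    using cD row D(4) by (intro eq_matI) (auto simp: mn E_def)
  moreover have "\<forall>i<m. \<forall>j<n. D $$ (0,0) dvd E $$ (i,j)"
    using minimal_pivot_dvd[OF D(2)] D(4) cD mn unfolding E_def by auto
  moreover have "E \<in> carrier_mat m n"
    unfolding E_def by auto
  moreover have "D $$ (0,0) \<noteq> 0"
    using D(2) unfolding minimal_pivot_def by auto
  ultimately show ?thesis
    using mn AD by metis
qed

text \<open>The corner is its own inverse. It is used with \<open>1\<close> and with the sign of the
  pivot, which makes the diagonal entry nonnegative.\<close>

lemma invertible_block_diag: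
  fixes P :: "int mat"
  assumes "P \<in> carrier_mat m m" "invertible_mat P" "e * e = 1"
  shows "invertible_mat (four_block_mat (mat 1 1 (\<lambda>_. e)) (0\<^sub>m 1 m) (0\<^sub>m m 1) P)"
proof -
  obtain P' where P': "P' \<in> carrier_mat m m" "P * P' = 1\<^sub>m m" "P' * P = 1\<^sub>m m"
    using assms invertible_mat_iff by metis
  let ?E = "mat 1 1 (\<lambda>_. e)"
  have E: "?E \<in> carrier_mat 1 1" "?E * ?E = 1\<^sub>m 1"
    using assms(3) by (auto intro!: eq_matI simp: scalar_prod_def)
  have *: "four_block_mat ?E (0\<^sub>m 1 m) (0\<^sub>m m 1) X * four_block_mat ?E (0\<^sub>m 1 m) (0\<^sub>m m 1) Y = 1\<^sub>m (1 + m)"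
    if "X \<in> carrier_mat m m" "Y \<in> carrier_mat m m" "X * Y = 1\<^sub>m m" for X Y :: "int mat"
    using that E
    by (subst mult_four_block_mat[of _ 1 1 _ m _ m _ _ 1 _ m]) (auto simp: four_block_one_mat[symmetric])
  show ?thesis
    using *[OF assms(1) P'(1,2)] *[OF P'(1) assms(1) P'(3)]
      invertible_mat_iff[OF four_block_carrier_mat[OF E(1) assms(1)]] four_block_carrier_mat[OF E(1) P'(1)] by blast
qed

lemma dvd_mult_mat:
  fixes d :: int
  assumes "A \<in> carrier_mat nr n" "B \<in> carrier_mat n nc" "i < nr" "j < nc"
    and "(\<forall>k<n. d dvd A $$ (i,k)) \<or> (\<forall>k<n. d dvd B $$ (k,j))"
  shows "d dvd (A * B) $$ (i,j)"
  using assms by (auto simp: scalar_prod_def intro!: dvd_sum)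

text \<open>Induction on the number of rows: split off a minimal pivot and diagonalise the remaining
  block. The divisibility chain holds because the pivot divides every entry of the block, hence
  every integer combination of them.\<close>

theorem smith_normal_form_exists:
  "\<exists>ds. is_invariant_factors A ds"
proof (induction "dim_row A" arbitrary: A rule: less_induct)
  case less
  define nr nc where "nr = dim_row A" and "nc = dim_col A"
  have A: "A \<in> carrier_mat nr nc"
    unfolding nr_def nc_def by auto
  show ?case
  proof (cases "A = 0\<^sub>m nr nc")
    \<comment> \<open>Matrices without rows or columns fall under this case as well.\<close>
    case True
    have "is_invariant_factors A (replicate (min nr nc) 0)"
      unfolding is_invariant_factors_def True
      by (intro conjI exI[of _ "1\<^sub>m nr"] exI[of _ "1\<^sub>m nc"]) (auto simp: invertible_one_mat)
    then show ?thesis ..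
  next
    case False
    obtain m n d B where mn: "nr = Suc m" "nc = Suc n" and d: "d \<noteq> 0" and B: "B \<in> carrier_mat m n"
      and dB: "\<And>i j. i < m \<Longrightarrow> j < n \<Longrightarrow> d dvd B $$ (i,j)"
      and eq: "unimodular_equiv A (four_block_mat (mat 1 1 (\<lambda>_. d)) (0\<^sub>m 1 n) (0\<^sub>m m 1) B)"
      using exists_pivot_block[OF A False] by blast
    obtain es where "is_invariant_factors B es"
      using less[of B] B mn nr_def by auto
    then obtain P Q where es: "length es = min m n" "\<And>i. i + 1 < length es \<Longrightarrow> es ! i dvd es ! (i + 1)"
      and P: "P \<in> carrier_mat m m" "invertible_mat P" and Q: "Q \<in> carrier_mat n n" "invertible_mat Q"
      and PBQ: "P * B * Q = mat m n (\<lambda>(i, j). if i = j then int (es ! i) else 0)"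
      using B unfolding is_invariant_factors_def by auto
    have d_es: "nat \<bar>d\<bar> dvd es ! i" if "i < min m n" for i
    proof -
      have "d dvd (P * B) $$ (i,j)" if "j < n" for j
        using that \<open>i < min m n\<close> dB by (intro dvd_mult_mat[OF P(1) B]) auto
      then have "d dvd (P * B * Q) $$ (i,i)"
        using that P B Q by (intro dvd_mult_mat[of _ m n _ n]) auto
      then have "d dvd int (es ! i)"
        unfolding PBQ using that by auto
      then show ?thesis
        by (simp add: nat_abs_dvd_iff)
    qed
    define P1 where "P1 = four_block_mat (mat 1 1 (\<lambda>_. sgn d)) (0\<^sub>m 1 m) (0\<^sub>m m 1) P"
    define Q1 where "Q1 = four_block_mat (mat 1 1 (\<lambda>_. 1)) (0\<^sub>m 1 n) (0\<^sub>m n 1) Q"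
    have PQ1: "P1 \<in> carrier_mat nr nr" "Q1 \<in> carrier_mat nc nc" "invertible_mat P1" "invertible_mat Q1"
      unfolding P1_def Q1_def using P Q d invertible_block_diag[OF P, of "sgn d"] invertible_block_diag[OF Q, of 1]
      by (auto simp: mn sgn_if)
    let ?M = "four_block_mat (mat 1 1 (\<lambda>_. d)) (0\<^sub>m 1 n) (0\<^sub>m m 1) B"
    have M: "?M \<in> carrier_mat nr nc"
      using B mn by auto
    let ?E = "\<lambda>x. mat 1 1 (\<lambda>_. x :: int)"
    have E: "?E x * ?E y = ?E (x * y)" "?E x \<in> carrier_mat 1 1" "?E x + 0\<^sub>m 1 1 = ?E x" for x y
      by (auto simp: scalar_prod_def intro!: eq_matI)
    have "P1 * ?M = four_block_mat (?E (sgn d * d)) (0\<^sub>m 1 n) (0\<^sub>m m 1) (P * B)"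
      unfolding P1_def using P B
      by (subst mult_four_block_mat[of _ 1 1 _ m _ m _ _ 1 _ n]) (simp_all add: E del: One_nat_def)
    then have "P1 * ?M * Q1 = four_block_mat (?E (sgn d * d)) (0\<^sub>m 1 n) (0\<^sub>m m 1) (P * B * Q)"
      unfolding Q1_def using P Q B
      by (simp only:, subst mult_four_block_mat[of _ 1 1 _ n _ m _ _ 1 _ n]) (simp_all add: E del: One_nat_def)
    also have "\<dots> = mat nr nc (\<lambda>(i, j). if i = j then int ((nat \<bar>d\<bar> # es) ! i) else 0)"
      unfolding PBQ
      by (intro eq_matI) (auto simp: mn nth_Cons' sgn_if)
    finally have "unimodular_equiv ?M (mat nr nc (\<lambda>(i, j). if i = j then int ((nat \<bar>d\<bar> # es) ! i) else 0))"
      by (intro unimodular_equivI[OF M PQ1(1,3,2,4)]) (rule sym)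
    from unimodular_equiv_trans[OF eq this]
    have "\<exists>P Q. P \<in> carrier_mat nr nr \<and> invertible_mat P \<and> Q \<in> carrier_mat nc nc \<and> invertible_mat Q \<and>
      P * A * Q = mat nr nc (\<lambda>(i, j). if i = j then int ((nat \<bar>d\<bar> # es) ! i) else 0)"
      unfolding unimodular_equiv_def nr_def nc_def by metis
    moreover have "(nat \<bar>d\<bar> # es) ! i dvd (nat \<bar>d\<bar> # es) ! (i + 1)" if "i + 1 < length (nat \<bar>d\<bar> # es)" for i
      using that es d_es by (cases i) auto
    ultimately have "is_invariant_factors A (nat \<bar>d\<bar> # es)"
      unfolding is_invariant_factors_def using es(1) mn nr_def nc_def by auto
    then show ?thesis ..
  qed
qed

subsection \<open>Matrices with constant row sum\<close>

lemma nat_power_of_prime: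
  fixes d p :: nat
  assumes "d \<noteq> 0" and "\<And>l. prime l \<Longrightarrow> l dvd d \<Longrightarrow> l = p"
  shows "\<exists>e. d = p ^ e"
proof (cases "prime p")
  case True
  have "prime_factors d \<subseteq> {p}"
    using assms(2) by (auto simp: prime_factors_dvd)
  then have "d = p ^ multiplicity p d"
    using prime_factorization_nat[of d] assms(1) True
    by (cases "prime_factors d = {}") (auto simp: subset_singleton_iff dest: not_dvd_imp_multiplicity_0)
  then show ?thesis ..
next
  \<comment> \<open>A prime divisor of \<open>d\<close> would equal \<open>p\<close>, which is not
    prime; so \<open>d\<close> has none and is \<open>p ^ 0\<close>.\<close>
  case False
  then have "d = 1"
    using assms(2) prime_factor_nat by metis
  then show ?thesis
    by (intro exI[of _ 0]) simp
qed

text \<open>\<open>diff\<close> is the dual form of the statement that \<open>p ^ s\<close> times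
  each difference of unit vectors lies in the row lattice of \<open>A\<close>: every functional
  modulo \<open>M\<close> killing the rows kills it. It bounds the prime divisors of the factors,
  while \<open>row_sum\<close> makes the all-one vector detect \<open>m\<close>.\<close>

lemma invariant_factors_if_constant_row_sum:
  fixes A :: "int mat" and m p s :: nat
  assumes A: "A \<in> carrier_mat nr v" and "0 < nr" "0 < v" and ds: "is_invariant_factors A ds"
    and p: "prime p" and m: "0 < m" "coprime m p"
    and row_sum: "\<And>i. i < nr \<Longrightarrow> (\<Sum>j<v. A $$ (i,j)) = int m"
    and diff: "\<And>M x j k. (\<And>i. i < nr \<Longrightarrow> M dvd (\<Sum>j<v. A $$ (i,j) * x j)) \<Longrightarrow> j < v \<Longrightarrow> k < v \<Longrightarrow>
      M dvd int (p ^ s) * (x j - x k)"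
  shows "length ds = v" and "i < v - 1 \<Longrightarrow> \<exists>e. ds ! i = p ^ e" and "\<exists>e. ds ! (v - 1) = p ^ e * m"
proof -
  define D where "D = mat nr v (\<lambda>(i, j). if i = j then int (ds ! i) else 0)"
  define N where "N = int (p ^ s)"
  have len: "length ds = min nr v" and succ_dvd: "\<And>i. i + 1 < length ds \<Longrightarrow> ds ! i dvd ds ! (i + 1)"
    using ds A unfolding is_invariant_factors_def by auto
  obtain P Q where P: "P \<in> carrier_mat nr nr" "invertible_mat P" and Q: "Q \<in> carrier_mat v v" "invertible_mat Q"
    and PAQ: "P * A * Q = D"
    using ds A unfolding is_invariant_factors_def D_def by auto
  obtain P' where P': "P' \<in> carrier_mat nr nr" "P * P' = 1\<^sub>m nr" "P' * P = 1\<^sub>m nr"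
    using P invertible_mat_iff by metis
  obtain Q' where Q': "Q' \<in> carrier_mat v v" "Q * Q' = 1\<^sub>m v" "Q' * Q = 1\<^sub>m v"
    using Q invertible_mat_iff by metis
  have cD: "D \<in> carrier_mat nr v"
    unfolding D_def by auto
  have AQ: "A * Q = P' * D"
  proof -
    have "P' * D = (P' * P) * (A * Q)"
      unfolding PAQ[symmetric] using P P'(1) Q A by (simp add: assoc_mult_mat[of _ nr nr _ v _ v] assoc_mult_mat[of _ nr nr _ nr _ v])
    then show ?thesis
      using P' A Q by simp
  qed
  have PA: "P * A = D * Q'"
  proof -
    have "D * Q' = (P * A) * (Q * Q')"
      unfolding PAQ[symmetric] using mult_carrier_mat[OF P(1) A] Q(1) Q'(1) by (rule assoc_mult_mat)
    then show ?thesis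
      unfolding Q'(2) using right_mult_one_mat[OF mult_carrier_mat[OF P(1) A]] by simp
  qed
  \<comment> \<open>Column \<open>j\<close> of \<open>A * Q = P' * D\<close> is a multiple of the
    \<open>j\<close>-th diagonal entry. For \<open>j \<ge> nr\<close> that column of
    \<open>D\<close> is zero, hence the default \<open>0\<close>.\<close>
  have col_dvd: "(if j < nr then int (ds ! j) else 0) dvd (\<Sum>k<v. A $$ (i,k) * Q $$ (k,j))"
    if "i < nr" "j < v" for i j
  proof -
    have "(if j < nr then int (ds ! j) else 0) dvd (P' * D) $$ (i,j)"
      using that by (intro dvd_mult_mat[OF P'(1) cD]) (auto simp: D_def)
    then show ?thesis
      unfolding AQ[symmetric] using that A Q by (simp add: scalar_prod_def atLeast0LessThan)
  qed
  have Q'Q: "(\<Sum>k<v. Q' $$ (i,k) * Q $$ (k,j)) = (if i = j then 1 else 0)" if "i < v" "j < v" for i j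
  proof -
    have "(Q' * Q) $$ (i,j) = (\<Sum>k<v. Q' $$ (i,k) * Q $$ (k,j))"
      using that Q(1) Q'(1) by (simp add: scalar_prod_def atLeast0LessThan)
    then show ?thesis
      unfolding Q'(3) using that by simp
  qed
  \<comment> \<open>The columns of the unimodular \<open>Q\<close> are primitive: row
    \<open>j\<close> of \<open>Q'\<close> combines the entries of column \<open>j\<close> to
    1.\<close>
  have primitive: "M dvd c" if "j < v" "\<And>k. k < v \<Longrightarrow> M dvd c * Q $$ (k,j)" for M c j
  proof -
    have "M dvd (\<Sum>k<v. Q' $$ (j,k) * (c * Q $$ (k,j)))"
      using that by (intro dvd_sum) (simp add: dvd_mult)
    also have "\<dots> = c * (\<Sum>k<v. Q' $$ (j,k) * Q $$ (k,j))"
      by (simp add: sum_distrib_left mult_ac)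
    finally show ?thesis
      using Q'Q[OF that(1) that(1)] by simp
  qed
  \<comment> \<open>Up to multiples of \<open>M\<close>, each \<open>N * x k\<close> may be replaced
    by \<open>N * x j\<close>; row 0, whose entries sum to \<open>m\<close>, then gives
    \<open>N * int m * x j\<close>.\<close>
  have scale: "M dvd N * int m * x j"
    if M: "\<And>i. i < nr \<Longrightarrow> M dvd (\<Sum>j<v. A $$ (i,j) * x j)" and j: "j < v" for M x j
  proof -
    have "M dvd N * (\<Sum>k<v. A $$ (0,k) * x k) + (\<Sum>k<v. A $$ (0,k) * (N * (x j - x k)))"
      using M \<open>0 < nr\<close> diff[OF M j] unfolding N_def by (intro dvd_add dvd_sum) (simp_all add: dvd_mult)
    also have "\<dots> = N * (\<Sum>k<v. A $$ (0,k)) * x j"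
      by (simp add: sum_distrib_left sum_distrib_right sum.distrib[symmetric] algebra_simps)
    finally show ?thesis
      using row_sum[OF \<open>0 < nr\<close>] by simp
  qed
  have dvd_Nm: "(if j < nr then int (ds ! j) else 0) dvd N * int m" if j: "j < v" for j
  proof (rule primitive[OF j])
    show "(if j < nr then int (ds ! j) else 0) dvd N * int m * Q $$ (k,j)" if "k < v" for k
      by (rule scale[of _ "\<lambda>k. Q $$ (k,j)", OF _ that]) (rule col_dvd[OF _ j])
  qed
  \<comment> \<open>If \<open>nr < v\<close>, the last column of \<open>D\<close> would be zero and
    \<open>0\<close> would divide this nonzero number.\<close>
  have "N * int m \<noteq> 0"
    unfolding N_def using p m by (auto simp: prime_gt_0_nat)
  then have "v \<le> nr"
    using dvd_Nm[of "v - 1"] \<open>0 < v\<close> by (auto split: if_splits)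
  then show len_v: "length ds = v"
    using len by simp
  have dvd_Nm_nat: "ds ! j dvd p ^ s * m" if "j < v" for j
  proof -
    have "int (ds ! j) dvd int (p ^ s * m)"
      using dvd_Nm[OF that] that \<open>v \<le> nr\<close> unfolding N_def by simp
    then show ?thesis
      by (simp only: int_dvd_int_iff)
  qed
  have chain: "i \<le> j \<Longrightarrow> j < v \<Longrightarrow> ds ! i dvd ds ! j" for i j
  proof (induction j rule: dec_induct)
    case (step j)
    then show ?case
      using succ_dvd[of j] len_v by (auto intro: dvd_trans)
  qed simp
  show power: "\<exists>e. ds ! i = p ^ e" if i: "i < v - 1" for i
  proof (rule nat_power_of_prime)
    show "ds ! i \<noteq> 0"
    proof
      assume "ds ! i = 0"
      then have "p ^ s * m = 0"
        using dvd_Nm_nat[of i] i by simp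
      then show False
        using m p by auto
    qed
  next
    fix l :: nat
    assume l: "prime l" "l dvd ds ! i"
    show "l = p"
    proof (rule ccontr)
      assume "l \<noteq> p"
      then have cop: "coprime (int l) N"
        unfolding N_def using l p by (auto simp: primes_coprime)
      \<comment> \<open>As \<open>ds ! i\<close> divides \<open>ds ! w\<close>, the matrix
        \<open>A\<close> kills both columns \<open>i\<close> and \<open>w\<close> of
        \<open>Q\<close> modulo \<open>l\<close>. Both are then constant modulo \<open>l\<close>,
        hence linearly dependent there, against the invertibility of \<open>Q\<close>.\<close>
      define w where "w = v - 1"
      have w: "w < v" "i < v" "i \<noteq> w"
        using i unfolding w_def by auto
      have const: "int l dvd Q $$ (k,j) - Q $$ (0,j)" if "j = i \<or> j = w" "k < v" for j k
      proof -
        have "l dvd ds ! j"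
          using that l chain[of i w] w i unfolding w_def by (auto intro: dvd_trans)
        then have "int l dvd (\<Sum>k<v. A $$ (i',k) * Q $$ (k,j))" if "i' < nr" for i'
          using col_dvd[OF that, of j] \<open>j = i \<or> j = w\<close> w \<open>v \<le> nr\<close> by (auto intro: dvd_trans[of "int l" "int (ds ! j)"])
        then have "int l dvd N * (Q $$ (k,j) - Q $$ (0,j))"
          unfolding N_def using that \<open>0 < v\<close> by (intro diff) auto
        then show ?thesis
          using cop by (simp add: coprime_dvd_mult_right_iff)
      qed
      define a b where "a = Q $$ (0,i)" and "b = Q $$ (0,w)"
      have comb: "int l dvd b * Q $$ (k,i) - a * Q $$ (k,w)" if "k < v" for k
      proof -
        have "b * Q $$ (k,i) - a * Q $$ (k,w) = b * (Q $$ (k,i) - a) - a * (Q $$ (k,w) - b)"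
          by (simp add: algebra_simps)
        then show ?thesis
          using const[of i k] const[of w k] that unfolding a_def b_def by auto
      qed
      \<comment> \<open>Row \<open>w\<close> of \<open>Q'\<close> extracts the coefficient
        \<open>- a\<close> of column \<open>w\<close>. So \<open>l\<close> divides \<open>a\<close>,
        and with it all of column \<open>i\<close>, which is primitive.\<close>
      have "int l dvd (\<Sum>k<v. Q' $$ (w,k) * (b * Q $$ (k,i) - a * Q $$ (k,w)))"
        using comb by (intro dvd_sum dvd_mult) auto
      also have "\<dots> = b * (\<Sum>k<v. Q' $$ (w,k) * Q $$ (k,i)) - a * (\<Sum>k<v. Q' $$ (w,k) * Q $$ (k,w))"
        by (simp add: sum_distrib_left sum_subtractf[symmetric] algebra_simps)
      also have "\<dots> = - a"
        using Q'Q w by simp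
      finally have "int l dvd a"
        by simp
      then have "int l dvd 1 * Q $$ (k,i)" if "k < v" for k
        using const[of i k] that unfolding a_def by (metis diff_add_cancel dvd_add mult_1)
      from primitive[OF w(2) this] show False
        using l by simp
    qed
  qed
  \<comment> \<open>\<open>u\<close> is \<open>Q'\<close> applied to the all-one vector. Since
    \<open>A\<close> sends that vector to \<open>m\<close> times an all-one vector, \<open>D\<close>
    sends \<open>u\<close> to a multiple of \<open>m\<close>.\<close>
  define u where "u j = (\<Sum>k<v. Q' $$ (j,k))" for j
  have u: "int m dvd int (ds ! j) * u j" if j: "j < v" for j
  proof -
    have "int (ds ! j) * Q' $$ (j,k) = (\<Sum>i<nr. P $$ (j,i) * A $$ (i,k))" if k: "k < v" for k
    proof -
      have "(D * Q') $$ (j,k) = (\<Sum>i<v. D $$ (j,i) * Q' $$ (i,k))"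
        using j k \<open>v \<le> nr\<close> Q'(1) cD by (simp add: scalar_prod_def atLeast0LessThan)
      also have "\<dots> = (\<Sum>i<v. if i = j then int (ds ! j) * Q' $$ (j,k) else 0)"
        using j \<open>v \<le> nr\<close> by (intro sum.cong) (auto simp: D_def)
      finally have "(D * Q') $$ (j,k) = int (ds ! j) * Q' $$ (j,k)"
        using j by simp
      moreover have "(P * A) $$ (j,k) = (\<Sum>i<nr. P $$ (j,i) * A $$ (i,k))"
        using j k \<open>v \<le> nr\<close> P A by (auto simp: scalar_prod_def atLeast0LessThan)
      ultimately show ?thesis
        unfolding PA using j by simp
    qed
    then have "int (ds ! j) * u j = (\<Sum>k<v. \<Sum>i<nr. P $$ (j,i) * A $$ (i,k))"
      unfolding u_def by (simp add: sum_distrib_left)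
    also have "\<dots> = (\<Sum>i<nr. P $$ (j,i) * (\<Sum>k<v. A $$ (i,k)))"
      by (subst sum.swap) (simp add: sum_distrib_left)
    also have "\<dots> = (\<Sum>i<nr. P $$ (j,i)) * int m"
      by (simp add: row_sum sum_distrib_right)
    finally show ?thesis
      by simp
  qed
  \<comment> \<open>\<open>Q\<close> sends \<open>u\<close> back to the all-one vector; this is
    coordinate 0 of that identity.\<close>
  have "(\<Sum>j<v. Q $$ (0,j) * u j) = (\<Sum>k<v. (Q * Q') $$ (0,k))"
  proof -
    have "(\<Sum>j<v. Q $$ (0,j) * u j) = (\<Sum>j<v. \<Sum>k<v. Q $$ (0,j) * Q' $$ (j,k))"
      unfolding u_def by (simp add: sum_distrib_left)
    also have "\<dots> = (\<Sum>k<v. \<Sum>j<v. Q $$ (0,j) * Q' $$ (j,k))"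
      by (rule sum.swap)
    also have "\<dots> = (\<Sum>k<v. (Q * Q') $$ (0,k))"
      using Q(1) Q'(1) \<open>0 < v\<close> by (auto simp: scalar_prod_def atLeast0LessThan intro!: sum.cong)
    finally show ?thesis .
  qed
  also have "\<dots> = 1"
    unfolding Q'(2) using \<open>0 < v\<close> by simp
  finally have one: "(\<Sum>j<v. Q $$ (0,j) * u j) = 1" .
  \<comment> \<open>For \<open>j < v - 1\<close> the factor \<open>ds ! j\<close> is a power of
    \<open>p\<close>, so \<open>m\<close> divides \<open>u j\<close> itself. Summing against row 0
    of \<open>Q\<close> then shows that \<open>m\<close> divides the last factor.\<close>
  have "int m dvd int (ds ! (v - 1)) * u j" if j: "j < v" for j
  proof (cases "j = v - 1")
    case False
    then have "j < v - 1"
      using j by simp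
    then obtain e where "ds ! j = p ^ e"
      using power by blast
    then have "int m dvd u j"
      using u[OF j] m(2) by (simp add: coprime_dvd_mult_right_iff)
    then show ?thesis
      by simp
  qed (use u[OF j] in simp)
  then have "int m dvd (\<Sum>j<v. Q $$ (0,j) * (int (ds ! (v - 1)) * u j))"
    by (intro dvd_sum) (simp add: dvd_mult)
  also have "\<dots> = int (ds ! (v - 1)) * (\<Sum>j<v. Q $$ (0,j) * u j)"
    by (simp add: sum_distrib_left mult_ac)
  finally have "m dvd ds ! (v - 1)"
    unfolding one by simp
  then obtain t where t: "ds ! (v - 1) = t * m"
    by (metis dvd_def mult.commute)
  then have "t dvd p ^ s"
    using dvd_Nm_nat[of "v - 1"] \<open>0 < v\<close> m by simp
  then show "\<exists>e. ds ! (v - 1) = p ^ e * m"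
    using t divides_primepow_nat[OF p] by auto
qed

subsection \<open>Points and subspaces over a finite field\<close>

abbreviation coordinate_subspace :: "'n set \<Rightarrow> ('a::field ^ 'n::finite) set" where
  "coordinate_subspace T \<equiv> {x. \<forall>s. s \<notin> T \<longrightarrow> vec_nth x s = 0}"

lemma subspace_coordinate_subspace: "vec.subspace (coordinate_subspace T)"
  by (auto simp: vec.subspace_def)

lemma coordinate_subspace_of_dim: "coordinate_subspace T \<in> subspaces_of_dim (card T)"
  unfolding subspaces_of_dim_def using subspace_coordinate_subspace dim_substandard_cart by blast

lemma card_coordinate_subspace:
  "card (coordinate_subspace T :: ('a::{field,finite} ^ 'n::finite) set) = CARD('a) ^ card T"
proof -
  have "bij_betw (\<lambda>x. restrict (vec_nth x) T) (coordinate_subspace T :: ('a ^ 'n) set) (PiE T (\<lambda>_. UNIV))"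
  proof (rule bij_betwI[of _ _ _ "\<lambda>f. vec_lambda (\<lambda>s. if s \<in> T then f s else 0)"])
    show "restrict (vec_nth (vec_lambda (\<lambda>s. if s \<in> T then f s else 0))) T = f"
      if "f \<in> PiE T (\<lambda>_. UNIV)" for f :: "'n \<Rightarrow> 'a"
      using that by (auto simp: fun_eq_iff PiE_def extensional_def restrict_def)
  qed (auto simp: Finite_Cartesian_Product.vec_eq_iff)
  then show ?thesis
    by (simp add: bij_betw_same_card card_PiE)
qed

text \<open>\<open>Y\<close> is isomorphic to a coordinate subspace of the same dimension, whose
  elements are counted by their free coordinates.\<close>

lemma card_subspace_of_dim:
  fixes Y :: "('a::{field,finite} ^ 'n::finite) set"
  assumes "Y \<in> subspaces_of_dim r"
  shows "card Y = CARD('a) ^ r"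
proof -
  have Y: "vec.subspace Y" "vec.dim Y = r"
    using assms unfolding subspaces_of_dim_def by auto
  have "r \<le> card (UNIV :: 'n set)"
    using vec.dim_subset_UNIV[of Y] Y by (simp add: vec.dimension_def card_cart_basis)
  then obtain T :: "'n set" where T: "card T = r"
    by (metis obtain_subset_with_card_n)
  define W where "W = (coordinate_subspace T :: ('a ^ 'n) set)"
  have W: "vec.subspace W" "vec.dim W = r"
    using coordinate_subspace_of_dim[of T] T unfolding W_def subspaces_of_dim_def by auto
  then obtain f where "f ` Y = W" "inj_on f Y"
    using vec.subspace_isomorphism[OF Y(1) W(1)] Y(2) by auto
  then have "card Y = card W"
    by (metis card_image)
  then show ?thesis
    unfolding W_def card_coordinate_subspace T .
qed

section \<open>Points as spans of single vectors\<close>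

lemma span_singleton_of_dim_1: "x \<noteq> 0 \<Longrightarrow> vec.span {x} \<in> subspaces_of_dim 1"
  unfolding subspaces_of_dim_def by (simp add: vec.dim_eq_card_independent)

lemma subspace_of_dim_1E:
  assumes "z \<in> subspaces_of_dim 1"
  obtains x where "x \<noteq> 0" "z = vec.span {x}"
proof -
  have z: "vec.subspace z" "vec.dim z = 1"
    using assms unfolding subspaces_of_dim_def by auto
  obtain B where B: "B \<subseteq> z" "vec.independent B" "z \<subseteq> vec.span B" "card B = 1"
    using vec.basis_exists[of z] z(2) by metis
  then obtain x where "B = {x}"
    by (auto simp: card_1_singleton_iff)
  then have "x \<noteq> 0" "z = vec.span {x}"
    using B z(1) vec.span_minimal[of B z] by auto
  then show ?thesis
    using that by blast
qed

lemma span_singleton_subset_iff: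
  "vec.subspace Y \<Longrightarrow> vec.span {x} \<subseteq> Y \<longleftrightarrow> x \<in> Y"
  using vec.span_minimal[of "{x}" Y] vec.span_base[of x "{x}"] by auto

lemma span_singleton_eq_iff:
  assumes "z \<in> subspaces_of_dim 1" "x \<noteq> 0"
  shows "vec.span {x} = z \<longleftrightarrow> x \<in> z"
proof
  assume "x \<in> z"
  moreover have "vec.subspace z" "vec.dim z = 1"
    using assms unfolding subspaces_of_dim_def by auto
  moreover have "vec.dim (vec.span {x}) = 1"
    using span_singleton_of_dim_1[OF assms(2)] unfolding subspaces_of_dim_def by auto
  ultimately show "vec.span {x} = z"
    by (intro vec.subspace_dim_equal) (auto simp: span_singleton_subset_iff)
next
  assume "vec.span {x} = z"
  then show "x \<in> z"
    using vec.span_base[of x "{x}"] by auto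
qed

text \<open>The nonzero vectors of \<open>Y\<close> are partitioned by its points, each contributing
  \<open>CARD('a) - 1\<close> of them.\<close>

lemma card_points_mult:
  fixes Y :: "('a::{field,finite} ^ 'n::finite) set"
  assumes Y: "Y \<in> subspaces_of_dim r"
  shows "card {z \<in> subspaces_of_dim 1. z \<subseteq> Y} * (CARD('a) - 1) = CARD('a) ^ r - 1"
proof -
  define L where "L = {z \<in> subspaces_of_dim 1. z \<subseteq> Y}"
  have Ys: "vec.subspace Y"
    using Y unfolding subspaces_of_dim_def by auto
  have zero: "0 \<in> z" if "z \<in> subspaces_of_dim 1" for z :: "('a ^ 'n) set"
    using that vec.subspace_0 unfolding subspaces_of_dim_def by auto
  have "Y - {0} = (\<Union>z\<in>L. z - {0})"
  proof (intro equalityI subsetI)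
    fix x
    assume "x \<in> Y - {0}"
    then have "vec.span {x} \<in> L" "x \<in> vec.span {x} - {0}"
      unfolding L_def using span_singleton_subset_iff[OF Ys] span_singleton_of_dim_1 vec.span_base[of x "{x}"] by auto
    then show "x \<in> (\<Union>z\<in>L. z - {0})"
      by blast
  qed (auto simp: L_def)
  moreover have "card (\<Union>z\<in>L. z - {0}) = (\<Sum>z\<in>L. card (z - {0}))"
  proof (rule card_UN_disjoint)
    show "\<forall>z\<in>L. \<forall>w\<in>L. z \<noteq> w \<longrightarrow> (z - {0}) \<inter> (w - {0}) = {}"
    proof (intro ballI impI equals0I)
      fix z w x
      assume "z \<in> L" "w \<in> L" "z \<noteq> w" "x \<in> (z - {0}) \<inter> (w - {0})"
      then show False
        using span_singleton_eq_iff[of z x] span_singleton_eq_iff[of w x] unfolding L_def by auto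
    qed
  qed auto
  moreover have "card (z - {0}) = CARD('a) - 1" if "z \<in> L" for z
    using that zero card_subspace_of_dim[of z 1] unfolding L_def by auto
  moreover have "card (Y - {0}) = CARD('a) ^ r - 1"
    using card_subspace_of_dim[OF Y] vec.subspace_0[OF Ys] by auto
  ultimately show ?thesis
    unfolding L_def[symmetric] by simp
qed

text \<open>
  The parameter \<open>c\<close> ranges over all of \<open>'a ^ 'n\<close> although only its coordinates in \<open>T\<close> matter, so
  every subspace is counted the same number of times, a power of the field size.
\<close>

definition sheared_subspace :: "'n set \<Rightarrow> 'n \<Rightarrow> 'n \<Rightarrow> ('a ^ 'n) \<Rightarrow> ('a::field ^ 'n::finite) set" where
  "sheared_subspace T i j c = {x. (\<forall>s. s \<notin> insert i (insert j T) \<longrightarrow> vec_nth x s = 0) \<and>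
    vec_nth x j + (\<Sum>s\<in>T. vec_nth c s * vec_nth x s) = 0}"

text \<open>The space is the image of the coordinate subspace on \<open>insert i T\<close> under the
  shear \<open>h\<close>, which changes only coordinate \<open>j\<close>. The sum over
  \<open>T\<close> is invariant under \<open>h\<close>, so \<open>h\<close> is injective.\<close>

lemma sheared_subspace_of_dim:
  fixes c :: "'a::field ^ 'n::finite"
  assumes "i \<notin> T" "j \<notin> T" "i \<noteq> j"
  shows "sheared_subspace T i j c \<in> subspaces_of_dim (Suc (card T))"
proof -
  define h where "h x = x - (\<Sum>s\<in>T. vec_nth c s * vec_nth x s) *s axis j 1" for x
  let ?W = "coordinate_subspace (insert i T) :: ('a ^ 'n) set"
  have h_nth: "vec_nth (h x) s = vec_nth x s - (if s = j then (\<Sum>s\<in>T. vec_nth c s * vec_nth x s) else 0)" for x s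
    unfolding h_def by (simp add: axis_def)
  have h: "Vector_Spaces.linear (*s) (*s) h"
    unfolding Vector_Spaces.linear_iff
    by (auto simp: vec.vector_space_axioms Finite_Cartesian_Product.vec_eq_iff h_nth algebra_simps sum.distrib sum_distrib_left)
  have sum_h: "(\<Sum>s\<in>T. vec_nth c s * vec_nth (h x) s) = (\<Sum>s\<in>T. vec_nth c s * vec_nth x s)" for x
    using assms by (intro sum.cong) (auto simp: h_nth)
  have "inj h"
  proof (rule injI)
    fix x y
    assume eq: "h x = h y"
    then have "(\<Sum>s\<in>T. vec_nth c s * vec_nth x s) = (\<Sum>s\<in>T. vec_nth c s * vec_nth y s)"
      by (metis sum_h)
    then show "x = y"
      using eq unfolding h_def by simp
  qed
  have image: "h ` ?W = sheared_subspace T i j c"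
  proof (intro equalityI subsetI)
    fix y
    assume "y \<in> h ` ?W"
    then show "y \<in> sheared_subspace T i j c"
      using assms unfolding sheared_subspace_def by (auto simp: sum_h) (auto simp: h_nth)
  next
    fix y
    assume y: "y \<in> sheared_subspace T i j c"
    \<comment> \<open>The preimage of \<open>y\<close> is found by erasing its coordinate
      \<open>j\<close>, which the defining equation determines from those in
      \<open>T\<close>.\<close>
    define x where "x = y - vec_nth y j *s axis j 1"
    have x_nth: "vec_nth x s = (if s = j then 0 else vec_nth y s)" for s
      unfolding x_def by (simp add: axis_def)
    have "(\<Sum>s\<in>T. vec_nth c s * vec_nth x s) = (\<Sum>s\<in>T. vec_nth c s * vec_nth y s)"
      using assms by (intro sum.cong) (auto simp: x_nth)
    moreover have "vec_nth y j = - (\<Sum>s\<in>T. vec_nth c s * vec_nth y s)"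
      using y unfolding sheared_subspace_def by (auto simp: eq_neg_iff_add_eq_0)
    ultimately have "h x = y"
      by (auto simp: Finite_Cartesian_Product.vec_eq_iff h_nth x_nth)
    moreover have "x \<in> ?W"
      using y unfolding sheared_subspace_def by (auto simp: x_nth)
    ultimately show "y \<in> h ` ?W"
      by blast
  qed
  have subspace: "vec.subspace (h ` ?W)"
    using vec.linear_subspace_image[OF h subspace_coordinate_subspace] .
  have "vec.dim (h ` ?W) = vec.dim ?W"
    by (rule vec.dim_image_eq[OF h inj_on_subset[OF \<open>inj h\<close> subset_UNIV]])
  also have "\<dots> = card (insert i T)"
    by (rule dim_substandard_cart)
  also have "\<dots> = Suc (card T)"
    using assms(1) by simp
  finally show ?thesis
    using subspace unfolding subspaces_of_dim_def image by blast
qed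

lemma span_axis: "vec.span {axis i (1::'a::field)} = {x :: 'a ^ 'n::finite. \<forall>s. s \<noteq> i \<longrightarrow> vec_nth x s = 0}"
proof (intro equalityI subsetI)
  fix x :: "'a ^ 'n"
  assume "x \<in> {x. \<forall>s. s \<noteq> i \<longrightarrow> vec_nth x s = 0}"
  then have "x = vec_nth x i *s axis i 1"
    by (auto simp: Finite_Cartesian_Product.vec_eq_iff axis_def)
  then show "x \<in> vec.span {axis i 1}"
    by (auto simp: vec.span_singleton)
qed (auto simp: vec.span_singleton axis_def)

text \<open>Inside the coordinate subspace on \<open>i\<close>, \<open>j\<close> and
  \<open>T\<close>, the two families are the hyperplanes through one of the axes \<open>i\<close>,
  \<open>j\<close> but not the other. A vector with a nonzero coordinate in \<open>T\<close> lies
  equally often in both; on the plane of the two axes membership does not depend on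
  \<open>c\<close>.\<close>

lemma card_sheared_subspaces_diff:
  fixes x :: "'a::{field,finite} ^ 'n::finite"
  assumes ij: "i \<notin> T" "j \<notin> T" "i \<noteq> j"
  shows "int (card {c. x \<in> sheared_subspace T i j c}) - int (card {c. x \<in> sheared_subspace T j i c}) =
    int (CARD('a ^ 'n)) * (of_bool (x \<in> vec.span {axis i 1}) - of_bool (x \<in> vec.span {axis j 1}))"
proof (cases "\<forall>s. s \<notin> insert i (insert j T) \<longrightarrow> vec_nth x s = 0")
  case supp: True
  define f where "f c = (\<Sum>s\<in>T. vec_nth c s * vec_nth x s)" for c
  have mem: "x \<in> sheared_subspace T i j c \<longleftrightarrow> vec_nth x j + f c = 0"
    "x \<in> sheared_subspace T j i c \<longleftrightarrow> vec_nth x i + f c = 0" for c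
    using supp unfolding sheared_subspace_def f_def by auto
  show ?thesis
  proof (cases "\<exists>s\<in>T. vec_nth x s \<noteq> 0")
    case True
    then obtain s where s: "s \<in> T" "vec_nth x s \<noteq> 0"
      by blast
    \<comment> \<open>With this \<open>d\<close>, \<open>f d\<close> is the difference of the
      coordinates \<open>j\<close> and \<open>i\<close> of \<open>x\<close>, so translation by
      \<open>d\<close> carries one membership condition into the other.\<close>
    define d where "d = axis s ((vec_nth x j - vec_nth x i) / vec_nth x s)"
    have "f d = (\<Sum>t\<in>T. if t = s then vec_nth x j - vec_nth x i else 0)"
      unfolding f_def d_def axis_def using s by (intro sum.cong) auto
    then have f_d: "f d = vec_nth x j - vec_nth x i"
      using s by simp
    have f_add: "f (c + d) = f c + f d" "f (c - d) = f c - f d" for c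
      unfolding f_def by (simp_all add: algebra_simps sum.distrib sum_subtractf)
    have "bij_betw (\<lambda>c. c + d) {c. x \<in> sheared_subspace T i j c} {c. x \<in> sheared_subspace T j i c}"
      by (rule bij_betwI[of _ _ _ "\<lambda>c. c - d"]) (auto simp: mem f_add f_d add.commute)
    then have "card {c. x \<in> sheared_subspace T i j c} = card {c. x \<in> sheared_subspace T j i c}"
      by (rule bij_betw_same_card)
    moreover have "x \<notin> vec.span {axis i 1}" "x \<notin> vec.span {axis j 1}"
      using s ij unfolding span_axis by auto
    ultimately show ?thesis
      by simp
  next
    case False
    then have "f c = 0" for c
      unfolding f_def by simp
    \<comment> \<open>Here \<open>x\<close> is supported on \<open>i\<close> and \<open>j\<close>,
      so each count is either 0 or the number of all parameters \<open>c\<close>.\<close>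
    moreover have "x \<in> vec.span {axis i 1} \<longleftrightarrow> vec_nth x j = 0" "x \<in> vec.span {axis j 1} \<longleftrightarrow> vec_nth x i = 0"
      unfolding span_axis using ij supp False by auto
    ultimately show ?thesis
      unfolding mem by simp
  qed
next
  case False
  then have "x \<notin> sheared_subspace T i j c" "x \<notin> sheared_subspace T j i c" for c
    unfolding sheared_subspace_def by auto
  moreover have "x \<notin> vec.span {axis i 1}" "x \<notin> vec.span {axis j 1}"
    using False unfolding span_axis by auto
  ultimately show ?thesis
    by simp
qed

text \<open>Two independent vectors can be moved to two coordinate axes, which reduces arbitrary
  pairs of points to the standard pair. An injective extension is bijective because the space is
  finite-dimensional.\<close>

lemma linear_bij_axes_exists:
  fixes v w :: "'a::field ^ 'n::finite"
  assumes "(i :: 'n) \<noteq> j" "v \<noteq> 0" "w \<notin> vec.span {v}"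
  shows "\<exists>g. Vector_Spaces.linear (*s) (*s) g \<and> bij g \<and> g (axis i 1) = v \<and> g (axis j 1) = w"
proof -
  have ax: "axis i 1 \<noteq> (axis j 1 :: 'a ^ 'n)"
    using assms(1) by (simp add: axis_eq_axis)
  define f where "f x = (if x = axis i 1 then v else w)" for x :: "'a ^ 'n"
  have f: "f (axis i 1) = v" "f (axis j 1) = w"
    unfolding f_def using ax by auto
  have "w \<noteq> v"
    using assms(3) vec.span_base[of v "{v}"] by auto
  have "vec.independent {axis i 1, axis j 1 :: 'a ^ 'n}"
    by (rule vec.independent_mono[OF independent_cart_basis]) (auto simp: cart_basis_def)
  moreover have "vec.independent (f ` {axis i 1, axis j 1})"
    using assms \<open>w \<noteq> v\<close> by (simp add: f insert_commute[of v] vec.independent_insert)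
  moreover have "inj_on f {axis i 1, axis j 1}"
    using \<open>w \<noteq> v\<close> by (auto simp: inj_on_def f)
  ultimately obtain g where g: "Vector_Spaces.linear (*s) (*s) g" "inj g" "\<forall>x\<in>{axis i 1, axis j 1}. g x = f x"
    using vec.linear_independent_extend_inj by metis
  then show ?thesis
    using f vec.linear_inj_imp_surj[OF g(1,2)] by (auto simp: bij_def)
qed

text \<open>Summing the hypothesis over both sheared families, transported by \<open>g\<close>, and
  subtracting cancels every point except \<open>z1\<close> and \<open>z2\<close>. The factor
  \<open>CARD('a ^ 'n)\<close> is the number of parameters \<open>c\<close>.\<close>

lemma dvd_point_difference:
  fixes x :: "('a::{field,finite} ^ 'n::finite) set \<Rightarrow> int"
  assumes r: "1 \<le> r" "r < CARD('n)"
    and M: "\<And>Y. Y \<in> subspaces_of_dim r \<Longrightarrow> M dvd (\<Sum>z | z \<in> subspaces_of_dim 1 \<and> z \<subseteq> Y. x z)"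
    and z: "z1 \<in> subspaces_of_dim 1" "z2 \<in> subspaces_of_dim 1"
  shows "M dvd int (CARD('a ^ 'n)) * (x z1 - x z2)"
proof (cases "z1 = z2")
  case False
  obtain v1 v2 where v: "v1 \<noteq> 0" "z1 = vec.span {v1}" "v2 \<noteq> 0" "z2 = vec.span {v2}"
    using z by (metis subspace_of_dim_1E)
  have "v2 \<notin> vec.span {v1}"
    using span_singleton_eq_iff[OF z(1) v(3)] v False by auto
  obtain i :: 'n where True
    by blast
  have "card (UNIV - {i}) \<noteq> 0"
    using r by (simp add: card_Diff_singleton)
  then obtain j where "j \<in> UNIV - {i}"
    by (metis card.empty equals0I)
  then have ij: "i \<noteq> j"
    by blast
  \<comment> \<open>With \<open>card T = r - 1\<close> the sheared subspaces have dimension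
    \<open>r\<close>.\<close>
  have "r - 1 \<le> card (UNIV - {i,j})"
    using r ij by (simp add: card_Diff_subset)
  then obtain T where T: "T \<subseteq> UNIV - {i,j}" "card T = r - 1"
    by (metis obtain_subset_with_card_n)
  have ijT: "i \<notin> T" "j \<notin> T" "j \<noteq> i"
    using T ij by auto
  obtain g where g: "Vector_Spaces.linear (*s) (*s) g" "bij g" "g (axis i 1) = v1" "g (axis j 1) = v2"
    using linear_bij_axes_exists[OF ij v(1) \<open>v2 \<notin> vec.span {v1}\<close>] by blast
  have g_mem: "g y \<in> g ` S \<longleftrightarrow> y \<in> S" for y S
    using g(2) by (auto simp: bij_def inj_def)
  have zg: "z1 = g ` vec.span {axis i 1}" "z2 = g ` vec.span {axis j 1}"
    using vec.linear_span_image[OF g(1), of "{axis i 1}"] vec.linear_span_image[OF g(1), of "{axis j 1}"] v g by simp_all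
  have dim_g: "g ` Y \<in> subspaces_of_dim r" if "Y \<in> subspaces_of_dim r" for Y
    using that vec.linear_subspace_image[OF g(1)] vec.dim_image_eq[OF g(1) inj_on_subset[OF bij_is_inj[OF g(2)]]]
    unfolding subspaces_of_dim_def by auto
  have dim_sheared: "sheared_subspace T i j c \<in> subspaces_of_dim r" "sheared_subspace T j i c \<in> subspaces_of_dim r"
    for c :: "'a ^ 'n"
    using sheared_subspace_of_dim[OF ijT(1,2) ij, of c] sheared_subspace_of_dim[OF ijT(2,1,3), of c] T(2) r by simp_all
  define L where "L = (subspaces_of_dim 1 :: ('a ^ 'n) set set)"
  define s where "s Y = (\<Sum>z | z \<in> L \<and> z \<subseteq> g ` Y. x z)" for Y
  \<comment> \<open>Double counting: each point is weighted by the number of parameters whose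
    subspace contains it.\<close>
  have swap: "(\<Sum>c\<in>UNIV. s (F c)) = (\<Sum>z\<in>L. x z * int (card {c. z \<subseteq> g ` F c}))" for F :: "'a ^ 'n \<Rightarrow> _"
  proof -
    have "(\<Sum>c\<in>UNIV. s (F c)) = (\<Sum>c\<in>UNIV. \<Sum>z\<in>L. if z \<subseteq> g ` F c then x z else 0)"
      unfolding s_def by (simp add: sum.If_cases Int_def)
    also have "\<dots> = (\<Sum>z\<in>L. \<Sum>c\<in>UNIV. if z \<subseteq> g ` F c then x z else 0)"
      by (rule sum.swap)
    also have "\<dots> = (\<Sum>z\<in>L. x z * int (card {c. z \<subseteq> g ` F c}))"
      by (simp add: sum.If_cases Int_def mult.commute)
    finally show ?thesis .
  qed
  have "M dvd (\<Sum>c\<in>UNIV. s (sheared_subspace T i j c) - s (sheared_subspace T j i c))"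
    unfolding s_def L_def by (intro dvd_sum dvd_diff M dim_g dim_sheared)
  also have "\<dots> = (\<Sum>c\<in>UNIV. s (sheared_subspace T i j c)) - (\<Sum>c\<in>UNIV. s (sheared_subspace T j i c))"
    by (rule sum_subtractf)
  also have "\<dots> = (\<Sum>z\<in>L. x z * (int (card {c. z \<subseteq> g ` sheared_subspace T i j c}) -
      int (card {c. z \<subseteq> g ` sheared_subspace T j i c})))"
    unfolding swap by (simp add: sum_subtractf[symmetric] right_diff_distrib)
  also have "\<dots> = (\<Sum>z\<in>L. x z * (int (CARD('a ^ 'n)) * (of_bool (z = z1) - of_bool (z = z2))))"
  proof (intro sum.cong refl arg_cong2[where f = "(*)"])
    fix z
    assume "z \<in> L"
    \<comment> \<open>A generator of \<open>z\<close> is pulled back along \<open>g\<close>, so that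
      all memberships become statements about \<open>y\<close> and the standard axes.\<close>
    then obtain y' where y': "y' \<noteq> 0" "z = vec.span {y'}"
      unfolding L_def by (rule subspace_of_dim_1E)
    then obtain y where y: "y' = g y"
      using g(2) by (metis bij_pointE)
    have sub: "z \<subseteq> g ` Y \<longleftrightarrow> y \<in> Y" if "Y \<in> subspaces_of_dim r" for Y
      using dim_g[OF that] span_singleton_subset_iff[of "g ` Y" y'] g_mem[of y Y] y' y
      unfolding subspaces_of_dim_def by auto
    have "z = z1 \<longleftrightarrow> y \<in> vec.span {axis i 1}" "z = z2 \<longleftrightarrow> y \<in> vec.span {axis j 1}"
      using span_singleton_eq_iff[OF z(1) y'(1)] span_singleton_eq_iff[OF z(2) y'(1)] y' y g_mem zg by auto
    then show "int (card {c. z \<subseteq> g ` sheared_subspace T i j c}) - int (card {c. z \<subseteq> g ` sheared_subspace T j i c}) =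
      int (CARD('a ^ 'n)) * (of_bool (z = z1) - of_bool (z = z2))"
      unfolding sub[OF dim_sheared(1)] sub[OF dim_sheared(2)]
      using card_sheared_subspaces_diff[OF ijT(1,2) ij, of y] by simp
  qed
  also have "\<dots> = int (CARD('a ^ 'n)) * ((\<Sum>z\<in>L. x z * of_bool (z = z1)) - (\<Sum>z\<in>L. x z * of_bool (z = z2)))"
    by (simp only: sum_distrib_left right_diff_distrib sum_subtractf mult.left_commute)
  also have "\<dots> = int (CARD('a ^ 'n)) * (x z1 - x z2)"
    using z unfolding L_def by (simp add: of_bool_def if_distrib sum.delta cong: if_cong)
  finally show ?thesis .
qed simp

section \<open>The incidence matrix of points and \<open>r\<close>-spaces\<close>

theorem theorem3p1:
  fixes p k q n r v :: nat
    and Ys Zs :: "('a::{field,finite} ^ 'n::finite) set list"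
    and A :: "int mat"
  assumes "prime p" and "k \<ge> 1" and "q = p ^ k"
    and "CARD('a) = q"
    and "n \<ge> 1" and "CARD('n) = n + 1"
    and "1 \<le> r" and "r \<le> n"
    and "distinct Ys" and "set Ys = subspaces_of_dim r"
    and "distinct Zs" and "set Zs = subspaces_of_dim 1"
    and "A = incidence_matrix Ys Zs"
    and "v = card (subspaces_of_dim 1 :: ('a ^ 'n) set set)"
  shows "(\<exists>ds. is_invariant_factors A ds) \<and>
    (\<forall>ds. is_invariant_factors A ds \<longrightarrow>
      length ds = v \<and>
      (\<forall>i < v - 1. \<exists>e. ds ! i = p ^ e) \<and>
      (\<exists>e. ds ! (v - 1) = p ^ e * ((q ^ r - 1) div (q - 1))))"
proof (rule conjI[OF smith_normal_form_exists], intro allI impI)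
  fix ds
  assume ds: "is_invariant_factors A ds"
  note p = \<open>prime p\<close> and k = \<open>k \<ge> 1\<close> and q = \<open>q = p ^ k\<close> \<open>CARD('a) = q\<close>
    and r = \<open>1 \<le> r\<close> \<open>r \<le> n\<close> and Ys = \<open>set Ys = subspaces_of_dim r\<close>
  define m where "m = (q ^ r - 1) div (q - 1)"
  have "q > 1"
    unfolding q(1) using one_less_power[OF prime_gt_1_nat[OF p]] k by simp
  have points: "card {z \<in> subspaces_of_dim 1. z \<subseteq> Y} = m" if "Y \<in> subspaces_of_dim r" for Y :: "('a ^ 'n) set"
    unfolding m_def card_points_mult[OF that, unfolded q(2), symmetric] using \<open>q > 1\<close> by simp
  \<comment> \<open>An actual \<open>r\<close>-space is required: it turns the point count into
    \<open>m * (q - 1) = q ^ r - 1\<close> and makes \<open>Ys\<close> nonempty.\<close>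
  have "\<exists>T :: 'n set. card T = r"
    using r \<open>CARD('n) = n + 1\<close> obtain_subset_with_card_n[of r "UNIV :: 'n set"] by auto
  then obtain Y0 :: "('a ^ 'n) set" where Y0: "Y0 \<in> subspaces_of_dim r"
    using coordinate_subspace_of_dim by blast
  have m_mult: "m * (q - 1) = q ^ r - 1"
    using card_points_mult[OF Y0] points[OF Y0] q by simp
  have "q ^ r > 1"
    using one_less_power[OF \<open>q > 1\<close>, of r] r by simp
  have "m > 0"
    using m_mult \<open>q ^ r > 1\<close> by (cases m) auto
  \<comment> \<open>\<open>p\<close> divides \<open>q ^ r\<close>, so it cannot divide
    \<open>q ^ r - 1\<close>, of which \<open>m\<close> is a divisor.\<close>
  have "coprime m p"
  proof (rule ccontr)
    assume "\<not> coprime m p"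
    then have "p dvd m"
      using p prime_imp_coprime coprime_commute by blast
    then have "p dvd q ^ r - 1"
      using m_mult by (metis dvd_mult2)
    moreover have "p dvd q ^ r"
      unfolding q(1) power_mult[symmetric] using k r by (intro dvd_power) simp
    ultimately have "p dvd 1"
      using \<open>q ^ r > 1\<close> by (metis dvd_diffD1 less_imp_le)
    then show False
      using p by simp
  qed
  have len: "length Zs = v"
    using assms distinct_card by metis
  have bij: "bij_betw ((!) Zs) {..<v} (subspaces_of_dim 1)"
    using bij_betw_nth[OF \<open>distinct Zs\<close>] len assms by auto
  have A: "A \<in> carrier_mat (length Ys) v"
    unfolding assms incidence_matrix_def using len assms by auto
  have sum_A: "(\<Sum>j<v. A $$ (i,j) * f (Zs ! j)) = (\<Sum>z | z \<in> subspaces_of_dim 1 \<and> z \<subseteq> Ys ! i. f z)"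
    if "i < length Ys" for i f
  proof -
    have "(\<Sum>j<v. A $$ (i,j) * f (Zs ! j)) = (\<Sum>j<v. if Zs ! j \<subseteq> Ys ! i then f (Zs ! j) else 0)"
      using that len unfolding \<open>A = incidence_matrix Ys Zs\<close> incidence_matrix_def by (intro sum.cong) auto
    also have "\<dots> = (\<Sum>z\<in>subspaces_of_dim 1. if z \<subseteq> Ys ! i then f z else 0)"
      by (rule sum.reindex_bij_betw[OF bij])
    also have "\<dots> = (\<Sum>z | z \<in> subspaces_of_dim 1 \<and> z \<subseteq> Ys ! i. f z)"
      by (simp add: sum.If_cases Int_def)
    finally show ?thesis .
  qed
  have row_sum: "(\<Sum>j<v. A $$ (i,j)) = int m" if "i < length Ys" for i
    using sum_A[OF that, of "\<lambda>_. 1"] points[of "Ys ! i"] Ys that nth_mem[OF that] by simp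
  \<comment> \<open>The exponent is chosen so that the power equals
    \<open>CARD('a ^ 'n)\<close>.\<close>
  have diff: "M dvd int (p ^ (k * CARD('n))) * (x j1 - x j2)"
    if M: "\<And>i. i < length Ys \<Longrightarrow> M dvd (\<Sum>j<v. A $$ (i,j) * x j)" and j: "j1 < v" "j2 < v"
    for M x j1 j2
  proof -
    \<comment> \<open>The vector \<open>x\<close>, indexed by positions in \<open>Zs\<close>, is
      read as a function on points.\<close>
    define f where "f z = x (inv_into {..<v} ((!) Zs) z)" for z
    have f: "f (Zs ! j) = x j" if "j < v" for j
      unfolding f_def using bij_betw_inv_into_left[OF bij] that by simp
    have "M dvd (\<Sum>z | z \<in> subspaces_of_dim 1 \<and> z \<subseteq> Y. f z)" if "Y \<in> subspaces_of_dim r" for Y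
    proof -
      obtain i where i: "i < length Ys" "Y = Ys ! i"
        using \<open>Y \<in> subspaces_of_dim r\<close> Ys by (metis in_set_conv_nth)
      have "(\<Sum>j<v. A $$ (i,j) * f (Zs ! j)) = (\<Sum>j<v. A $$ (i,j) * x j)"
        by (intro sum.cong) (auto simp: f)
      then show ?thesis
        using M[OF i(1)] sum_A[OF i(1), of f] i(2) by simp
    qed
    moreover have "Zs ! j1 \<in> subspaces_of_dim 1" "Zs ! j2 \<in> subspaces_of_dim 1"
      using bij j by (auto simp: bij_betw_def)
    ultimately have "M dvd int (CARD('a ^ 'n)) * (f (Zs ! j1) - f (Zs ! j2))"
      using r \<open>CARD('n) = n + 1\<close> by (intro dvd_point_difference[of r]) auto
    then show ?thesis
      using f j q by (simp add: power_mult)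
  qed
  have "vec.span {axis undefined 1 :: 'a ^ 'n} \<in> subspaces_of_dim 1"
    by (rule span_singleton_of_dim_1) (simp add: axis_eq_0_iff)
  then have "v > 0"
    using \<open>v = _\<close> by (auto simp: card_gt_0_iff)
  have "length Ys > 0"
    using Y0 Ys by auto
  note factors = invariant_factors_if_constant_row_sum[OF A \<open>length Ys > 0\<close> \<open>v > 0\<close> ds p \<open>m > 0\<close> \<open>coprime m p\<close> row_sum diff]
  show "length ds = v \<and> (\<forall>i < v - 1. \<exists>e. ds ! i = p ^ e) \<and>
    (\<exists>e. ds ! (v - 1) = p ^ e * ((q ^ r - 1) div (q - 1)))"
    unfolding m_def[symmetric] using factors by blast
qed

end
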